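(* Let $d\ge5$, let $A,B$ be linearly independent binary forms of order $d$ over $\mathbf{C}$, and put $T_i=(A,B)_i$. Define $$\alpha_1=-\frac{2(2d-3)^2}{d(d-2)},\quad \alpha_2=\frac{4(2d-3)(d-3)}{d(d-2)},\quad \alpha_3=1,\quad \alpha_4=\frac{(d-3)(d-4)(2d-3)^2}{d(2d-5)(2d-7)(d-2)}.$$ Then $$T_5=\frac{1}{T_1}\left(\frac{\alpha_1}{\alpha_4}\,(T_1,T_1)_4+\frac{\alpha_2}{\alpha_4}\,(T_1,T_3)_2+\frac{\alpha_3}{\alpha_4}\,T_3^2\right).$$
   Context: A form of order $e$ is a homogeneous polynomial of degree $e$ in $(x_0,x_1)$ over $\mathbf{C}$. For forms $E,F$ of orders $e,f$ and $0\le r\le\min\{e,f\}$, the $r$-th transvectant is $$(E,F)_r=\frac{(e-r)!(f-r)!}{e!f!}\sum_{i=0}^r(-1)^i\binom{r}{i}\frac{\partial^rE}{\partial x_0^{r-i}\partial x_1^i}\,\frac{\partial^rF}{\partial x_0^i\partial x_1^{r-i}},$$ a form of order $e+f-2r$, and $(E,F)_r=0$ for $r>\min\{e,f\}$. Since $A,B$ are linearly independent, $T_1\neq0$; the identity is in the field of rational functions $\mathbf{C}(x_0,x_1)$. *)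

theory Defs
  imports Complex_Main "HOL-Computational_Algebra.Polynomial_Factorial"
begin

text \<open>
  Polynomials in $x_0, x_1$ over the complex numbers are rendered as iterated univariate
  polynomials, with $x_0$ the variable of the inner (coefficient) polynomials and $x_1$ the
  outer variable: the coefficient of $x_0^i x_1^j$ in \<open>P\<close> is \<open>coeff (coeff P j) i\<close>.
\<close>

type_synonym bipoly = "complex poly poly"

definition bconst :: "complex \<Rightarrow> bipoly" where
  "bconst c = [:[:c:]:]"

text \<open>As usual, the zero polynomial is a form of every order.\<close>

definition is_form :: "nat \<Rightarrow> bipoly \<Rightarrow> bool" where
  "is_form e P \<longleftrightarrow> (\<forall>i j. coeff (coeff P j) i \<noteq> 0 \<longrightarrow> i + j = e)"

definition lin_indep2 :: "bipoly \<Rightarrow> bipoly \<Rightarrow> bool" where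
  "lin_indep2 A B \<longleftrightarrow>
     (\<forall>a b :: complex. bconst a * A + bconst b * B = 0 \<longrightarrow> a = 0 \<and> b = 0)"

definition D0 :: "bipoly \<Rightarrow> bipoly" where
  "D0 P = map_poly pderiv P"

definition D1 :: "bipoly \<Rightarrow> bipoly" where
  "D1 P = pderiv P"

text \<open>
  \<open>transvectant e f r E F\<close> is $(E,F)_r$ for forms \<open>E\<close>, \<open>F\<close> of orders \<open>e\<close>, \<open>f\<close>.  The orders are
  explicit arguments because the zero form does not determine its order.
\<close>

definition transvectant :: "nat \<Rightarrow> nat \<Rightarrow> nat \<Rightarrow> bipoly \<Rightarrow> bipoly \<Rightarrow> bipoly" where
  "transvectant e f r E F =
     (if r \<le> min e f then
        bconst ((fact (e - r) * fact (f - r)) / (fact e * fact f)) *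
        (\<Sum>i\<le>r. bconst ((-1) ^ i * of_nat (r choose i)) *
           (D0 ^^ (r - i)) ((D1 ^^ i) E) * (D0 ^^ i) ((D1 ^^ (r - i)) F))
      else 0)"

definition alpha1 :: "nat \<Rightarrow> complex" where
  "alpha1 d = (let n = of_nat d in - (2 * (2 * n - 3)\<^sup>2 / (n * (n - 2))))"

definition alpha2 :: "nat \<Rightarrow> complex" where
  "alpha2 d = (let n = of_nat d in 4 * (2 * n - 3) * (n - 3) / (n * (n - 2)))"

definition alpha3 :: "nat \<Rightarrow> complex" where
  "alpha3 d = 1"

definition alpha4 :: "nat \<Rightarrow> complex" where
  "alpha4 d = (let n = of_nat d in
     (n - 3) * (n - 4) * (2 * n - 3)\<^sup>2 / (n * (2 * n - 5) * (2 * n - 7) * (n - 2)))"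

end

theory Submission
  imports Defs
begin

text \<open>
  Write $x_0^r (E,F)_r$ in terms of the derivatives in $x_1$ alone. If the $k$-th derivative of a
  form $E$ of order $e$ is normalised to $E_k = \frac{(e-k)!}{e!} \partial_1^k E$, Euler's relation
  turns the transvectant into the alternating binomial sum
  $x_0^r (E,F)_r = \sum_i (-1)^i \binom{r}{i} E_i F_{r-i}$ (\<open>transvectant_jet\<close>). No other
  derivatives remain, and $x_0$ is a constant for $\partial_1$, so iterated transvectants can be
  computed as well.

  For $A, B$ of order $d$ put $p_{ij} = A_i B_j - A_j B_i$. Then $x_0 T_1 = p_{01}$,
  $x_0^3 T_3 = p_{03} - 3 p_{12}$ and $x_0^5 T_5 = p_{05} - 5 p_{14} + 10 p_{23}$. Since
  $\partial_1 p_{ij} = (d-i) p_{i+1,j} + (d-j) p_{i,j+1}$, the normalised derivatives of $T_1$ and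
  $T_3$ are linear in the $p_{ij}$ too. Multiplied by $x_0^6$, the claim becomes a relation between
  quadratic expressions of weight 6 in the $p_{ij}$. In this weight the only relation among the
  products of two $p_{ij}$ is the Pluecker relation
  $p_{01} p_{23} - p_{02} p_{13} + p_{03} p_{12} = 0$, and the difference of the two sides is a
  multiple of it (\<open>syzygy_of_brackets\<close>).

  It remains to divide by $T_1$. As $x_0 T_1$ is a nonzero multiple of the Wronskian
  $A \partial_1 B - B \partial_1 A$, it vanishes only for dependent $A, B$
  (\<open>lin_indep2_imp_Wronskian_neq_0\<close>).
\<close>

section \<open>The ring of bipolynomials\<close>

definition X0 :: bipoly where "X0 = [:[:0, 1:]:]"
definition X1 :: bipoly where "X1 = [:0, 1:]"

lemma bconst_0 [simp]: "bconst 0 = 0"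
  and bconst_1 [simp]: "bconst 1 = 1"
  and bconst_add: "bconst (a + b) = bconst a + bconst b"
  and bconst_diff: "bconst (a - b) = bconst a - bconst b"
  and bconst_uminus: "bconst (- a) = - bconst a"
  and bconst_mult: "bconst (a * b) = bconst a * bconst b"
  by (simp_all add: bconst_def one_pCons)

lemma bconst_eq_0_iff [simp]: "bconst c = 0 \<longleftrightarrow> c = 0"
  by (simp add: bconst_def)

lemma bconst_power: "bconst (a ^ k) = bconst a ^ k"
  by (induction k) (simp_all add: bconst_mult)

lemma bconst_of_nat: "bconst (of_nat n) = of_nat n"
  by (induction n) (simp_all add: bconst_add)

lemma bconst_numeral: "bconst (numeral k) = numeral k"
  using bconst_of_nat[of "numeral k"] by simp

lemmas bconst_hom = bconst_add bconst_diff bconst_uminus bconst_mult bconst_power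
  bconst_of_nat bconst_numeral

lemma coeff_bconst_mult: "coeff (bconst c * P) j = smult c (coeff P j)"
  by (simp add: bconst_def)

lemma coeff_D0: "coeff (D0 P) j = pderiv (coeff P j)"
  by (simp add: D0_def coeff_map_poly)

lemma D0_D1_commute: "D0 (D1 P) = D1 (D0 P)"
  by (intro poly_eqI)
    (simp add: coeff_D0 D1_def coeff_pderiv pderiv_mult pderiv_of_nat del: of_nat_Suc)

lemma D0_D1_pow_commute: "D0 ((D1 ^^ i) P) = (D1 ^^ i) (D0 P)"
  by (induction i) (simp_all add: D0_D1_commute)

lemma D1_D0_pow_commute: "D1 ((D0 ^^ i) P) = (D0 ^^ i) (D1 P)"
  by (induction i) (simp_all flip: D0_D1_commute)

lemma D1_add: "D1 (P + Q) = D1 P + D1 Q"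
  and D1_diff: "D1 (P - Q) = D1 P - D1 Q"
  and D1_mult: "D1 (P * Q) = D1 P * Q + P * D1 Q"
  by (simp_all add: D1_def pderiv_add pderiv_diff pderiv_mult algebra_simps)

lemma D1_of_nat [simp]: "D1 (of_nat n) = 0"
  by (simp add: D1_def pderiv_of_nat)

lemma D1_numeral [simp]: "D1 (numeral k) = 0"
  using D1_of_nat[of "numeral k"] by simp

lemma D1_one [simp]: "D1 1 = 0"
  using D1_of_nat[of 1] by simp

lemma D1_bconst [simp]: "D1 (bconst c) = 0"
  by (simp add: D1_def bconst_def)

lemma D1_X0 [simp]: "D1 X0 = 0"
  by (simp add: D1_def X0_def)

lemma D1_X0_power [simp]: "D1 (X0 ^ k) = 0"
  by (induction k) (simp_all add: D1_mult)

section \<open>Forms\<close>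

lemma is_form_D1:
  assumes "is_form e P"
  shows "is_form (e - 1) (D1 P)"
  unfolding is_form_def
proof (intro allI impI)
  fix i j assume "coeff (coeff (D1 P) j) i \<noteq> 0"
  hence "coeff (coeff P (Suc j)) i \<noteq> 0"
    by (auto simp: D1_def coeff_pderiv of_nat_poly simp del: of_nat_Suc)
  with assms have "i + Suc j = e"
    unfolding is_form_def by blast
  thus "i + j = e - 1" by simp
qed

lemma is_form_D0:
  assumes "is_form e P"
  shows "is_form (e - 1) (D0 P)"
  unfolding is_form_def
proof (intro allI impI)
  fix i j assume "coeff (coeff (D0 P) j) i \<noteq> 0"
  hence "coeff (coeff P j) (Suc i) \<noteq> 0"
    by (auto simp: coeff_D0 coeff_pderiv simp del: of_nat_Suc)
  with assms have "Suc i + j = e"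
    unfolding is_form_def by blast
  thus "i + j = e - 1" by simp
qed

lemma is_form_D1_pow: "is_form e P \<Longrightarrow> is_form (e - k) ((D1 ^^ k) P)"
proof (induction k)
  case (Suc k)
  from is_form_D1[OF Suc.IH[OF Suc.prems]] show ?case by simp
qed simp

lemma is_form_D0_pow: "is_form e P \<Longrightarrow> is_form (e - k) ((D0 ^^ k) P)"
proof (induction k)
  case (Suc k)
  from is_form_D0[OF Suc.IH[OF Suc.prems]] show ?case by simp
qed simp

lemma is_form_0: "is_form e 0"
  by (simp add: is_form_def)

lemma is_form_add:
  assumes "is_form e P" "is_form e Q"
  shows "is_form e (P + Q)"
  unfolding is_form_def
proof (intro allI impI)
  fix i j assume "coeff (coeff (P + Q) j) i \<noteq> 0"
  hence "coeff (coeff P j) i \<noteq> 0 \<or> coeff (coeff Q j) i \<noteq> 0" by auto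
  thus "i + j = e" using assms unfolding is_form_def by blast
qed

lemma is_form_sum: "(\<And>i. i \<in> S \<Longrightarrow> is_form e (f i)) \<Longrightarrow> is_form e (sum f S)"
  by (induction S rule: infinite_finite_induct) (auto intro: is_form_0 is_form_add)

lemma is_form_bconst_mult: "is_form e P \<Longrightarrow> is_form e (bconst c * P)"
  by (auto simp: is_form_def coeff_bconst_mult)

lemma is_form_mult:
  assumes "is_form e P" "is_form f Q"
  shows "is_form (e + f) (P * Q)"
  unfolding is_form_def
proof (intro allI impI)
  fix i j assume "coeff (coeff (P * Q) j) i \<noteq> 0"
  hence "(\<Sum>k\<le>j. \<Sum>l\<le>i. coeff (coeff P k) l * coeff (coeff Q (j - k)) (i - l)) \<noteq> 0"
    by (simp add: coeff_mult coeff_sum)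
  then obtain k where k: "k \<le> j"
      and "(\<Sum>l\<le>i. coeff (coeff P k) l * coeff (coeff Q (j - k)) (i - l)) \<noteq> 0"
    by (meson atMost_iff sum.not_neutral_contains_not_neutral)
  then obtain l where l: "l \<le> i"
      and "coeff (coeff P k) l * coeff (coeff Q (j - k)) (i - l) \<noteq> 0"
    by (meson atMost_iff sum.not_neutral_contains_not_neutral)
  hence "coeff (coeff P k) l \<noteq> 0" "coeff (coeff Q (j - k)) (i - l) \<noteq> 0"
    by auto
  with assms have "l + k = e" "(i - l) + (j - k) = f"
    unfolding is_form_def by blast+
  with k l show "i + j = e + f" by linarith
qed

lemma is_form_transvectant:
  assumes "is_form e E" "is_form f F"
  shows "is_form (e + f - 2 * r) (transvectant e f r E F)"
proof (cases "r \<le> min e f")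
  case True
  have "is_form (e + f - 2 * r)
      (bconst c * (D0 ^^ (r - i)) ((D1 ^^ i) E) * (D0 ^^ i) ((D1 ^^ (r - i)) F))"
    if "i \<le> r" for i c
  proof -
    have "is_form ((e - i - (r - i)) + (f - (r - i) - i))
        (bconst c * (D0 ^^ (r - i)) ((D1 ^^ i) E) * (D0 ^^ i) ((D1 ^^ (r - i)) F))"
      by (intro is_form_mult is_form_bconst_mult is_form_D0_pow is_form_D1_pow assms)
    moreover have "(e - i - (r - i)) + (f - (r - i) - i) = e + f - 2 * r"
      using True that by auto
    ultimately show ?thesis by simp
  qed
  thus ?thesis
    using True unfolding transvectant_def
    by (auto intro!: is_form_bconst_mult is_form_sum)
qed (simp add: transvectant_def is_form_0 del: min.bounded_iff)

lemma Euler: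
  assumes "is_form e P"
  shows "X0 * D0 P = of_nat e * P - X1 * D1 P"
proof -
  have "coeff (coeff (X0 * D0 P + X1 * D1 P) j) i = coeff (coeff (bconst (of_nat e) * P) j) i"
    for i j
  proof -
    have "coeff (coeff (X0 * D0 P + X1 * D1 P) j) i = of_nat (i + j) * coeff (coeff P j) i"
      by (cases i; cases j)
        (simp_all add: X0_def X1_def coeff_D0 D1_def coeff_pderiv of_nat_poly coeff_pCons algebra_simps)
    also have "\<dots> = of_nat e * coeff (coeff P j) i"
      using assms unfolding is_form_def by (cases "coeff (coeff P j) i = 0") auto
    finally show ?thesis by (simp add: coeff_bconst_mult)
  qed
  hence "X0 * D0 P + X1 * D1 P = bconst (of_nat e) * P"
    by (intro poly_eqI)
  thus ?thesis by (simp add: bconst_of_nat algebra_simps)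
qed

section \<open>Transvectants as brackets of jets\<close>

text \<open>
  Transvectants and brackets of jets are both alternating binomial sums. This form of Pascal's rule
  is what turns each of them into a recursion in \<open>r\<close>.
\<close>

lemma alternating_Pascal_sum:
  fixes g :: "nat \<Rightarrow> 'a::comm_ring_1"
  shows "(\<Sum>i\<le>Suc r. (-1) ^ i * of_nat (Suc r choose i) * g i) =
    (\<Sum>i\<le>r. (-1) ^ i * of_nat (r choose i) * g i) -
    (\<Sum>i\<le>r. (-1) ^ i * of_nat (r choose i) * g (Suc i))"
proof -
  have "(\<Sum>i\<le>r. (-1) ^ i * of_nat (r choose i) * g i) =
      (\<Sum>i\<le>Suc r. (-1) ^ i * of_nat (r choose i) * g i)"
    by (simp add: binomial_eq_0)
  also have "\<dots> = g 0 - (\<Sum>i\<le>r. (-1) ^ i * of_nat (r choose Suc i) * g (Suc i))"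
    by (subst sum.atMost_Suc_shift) (simp add: sum_negf)
  finally have shift: "(\<Sum>i\<le>r. (-1) ^ i * of_nat (r choose i) * g i) =
      g 0 - (\<Sum>i\<le>r. (-1) ^ i * of_nat (r choose Suc i) * g (Suc i))" .
  have "(\<Sum>i\<le>Suc r. (-1) ^ i * of_nat (Suc r choose i) * g i) =
      g 0 - (\<Sum>i\<le>r. (-1) ^ i * of_nat (Suc r choose Suc i) * g (Suc i))"
    by (subst sum.atMost_Suc_shift) (simp add: sum_negf)
  thus ?thesis
    unfolding shift by (simp add: algebra_simps sum.distrib)
qed

text \<open>
  Cayley's Omega process: the operator
  $\partial_0 \otimes \partial_1 - \partial_1 \otimes \partial_0$ is applied \<open>r\<close> times to
  $E \otimes F$, and the two sets of variables are then identified. It is the transvectant without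
  its normalising factor.
\<close>

definition Omega_process :: "nat \<Rightarrow> bipoly \<Rightarrow> bipoly \<Rightarrow> bipoly" where
  "Omega_process r E F = (\<Sum>i\<le>r. (-1) ^ i * of_nat (r choose i) *
     ((D0 ^^ (r - i)) ((D1 ^^ i) E) * (D0 ^^ i) ((D1 ^^ (r - i)) F)))"

lemma transvectant_Omega_process:
  assumes "r \<le> e" "r \<le> f"
  shows "transvectant e f r E F =
    bconst (fact (e - r) * fact (f - r) / (fact e * fact f)) * Omega_process r E F"
  using assms by (simp add: transvectant_def Omega_process_def bconst_hom mult.assoc)

lemma Omega_process_Suc:
  "Omega_process (Suc r) E F = Omega_process r (D0 E) (D1 F) - Omega_process r (D1 E) (D0 F)"
proof -
  let ?g = "\<lambda>i. (D0 ^^ (Suc r - i)) ((D1 ^^ i) E) * (D0 ^^ i) ((D1 ^^ (Suc r - i)) F)"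
  have 1: "?g i = (D0 ^^ (r - i)) ((D1 ^^ i) (D0 E)) * (D0 ^^ i) ((D1 ^^ (r - i)) (D1 F))"
    if "i \<le> r" for i
    using that by (simp add: Suc_diff_le funpow_Suc_right D0_D1_pow_commute del: funpow.simps)
  have 2: "?g (Suc i) = (D0 ^^ (r - i)) ((D1 ^^ i) (D1 E)) * (D0 ^^ i) ((D1 ^^ (r - i)) (D0 F))"
    for i
    by (simp add: funpow_Suc_right D0_D1_pow_commute del: funpow.simps)
  have "Omega_process (Suc r) E F =
      (\<Sum>i\<le>r. (-1) ^ i * of_nat (r choose i) * ?g i) -
      (\<Sum>i\<le>r. (-1) ^ i * of_nat (r choose i) * ?g (Suc i))"
    unfolding Omega_process_def by (rule alternating_Pascal_sum)
  also have "(\<Sum>i\<le>r. (-1) ^ i * of_nat (r choose i) * ?g i) = Omega_process r (D0 E) (D1 F)"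
    unfolding Omega_process_def by (intro sum.cong refl) (simp only: 1 atMost_iff)
  also have "(\<Sum>i\<le>r. (-1) ^ i * of_nat (r choose i) * ?g (Suc i)) = Omega_process r (D1 E) (D0 F)"
    unfolding Omega_process_def by (intro sum.cong refl) (simp only: 2)
  finally show ?thesis .
qed

text \<open>
  In each summand the innermost \<open>D0\<close> can be moved outside, where it acts on a form of order
  \<open>e - r\<close>, and Euler's relation applies.
\<close>

lemma X0_Omega_process_D0_left:
  assumes "is_form e E" "r \<le> e"
  shows "X0 * Omega_process r (D0 E) F = of_nat (e - r) * Omega_process r E F - X1 * Omega_process r (D1 E) F"
proof -
  have *: "X0 * (D0 ^^ (r - i)) ((D1 ^^ i) (D0 E)) =
      of_nat (e - r) * (D0 ^^ (r - i)) ((D1 ^^ i) E) - X1 * (D0 ^^ (r - i)) ((D1 ^^ i) (D1 E))"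
    if "i \<le> r" for i
  proof -
    have "is_form (e - i - (r - i)) ((D0 ^^ (r - i)) ((D1 ^^ i) E))"
      by (intro is_form_D0_pow is_form_D1_pow assms)
    hence "is_form (e - r) ((D0 ^^ (r - i)) ((D1 ^^ i) E))"
      using that by simp
    from Euler[OF this] show ?thesis
      by (simp add: D0_D1_pow_commute D1_D0_pow_commute funpow_swap1)
  qed
  have "X0 * Omega_process r (D0 E) F = (\<Sum>i\<le>r. (-1) ^ i * of_nat (r choose i) *
      (X0 * (D0 ^^ (r - i)) ((D1 ^^ i) (D0 E)) * (D0 ^^ i) ((D1 ^^ (r - i)) F)))"
    unfolding Omega_process_def sum_distrib_left by (intro sum.cong refl) (simp only: ac_simps)
  also have "\<dots> = (\<Sum>i\<le>r. (-1) ^ i * of_nat (r choose i) *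
      ((of_nat (e - r) * (D0 ^^ (r - i)) ((D1 ^^ i) E) - X1 * (D0 ^^ (r - i)) ((D1 ^^ i) (D1 E)))
        * (D0 ^^ i) ((D1 ^^ (r - i)) F)))"
    by (intro sum.cong refl) (simp only: * atMost_iff)
  also have "\<dots> = of_nat (e - r) * Omega_process r E F - X1 * Omega_process r (D1 E) F"
    unfolding Omega_process_def sum_distrib_left sum_subtractf [symmetric]
    by (intro sum.cong refl) (simp only: algebra_simps)
  finally show ?thesis .
qed

lemma Omega_process_swap: "Omega_process r E F = (-1) ^ r * Omega_process r F E"
proof -
  have "Omega_process r E F = (\<Sum>i\<le>r. (-1) ^ (r - i) * of_nat (r choose (r - i)) *
     ((D0 ^^ (r - (r - i))) ((D1 ^^ (r - i)) E) * (D0 ^^ (r - i)) ((D1 ^^ (r - (r - i))) F)))"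
    unfolding Omega_process_def atMost_atLeast0 by (subst sum.atLeastAtMost_rev) simp
  also have "\<dots> = (-1) ^ r * Omega_process r F E"
    unfolding Omega_process_def sum_distrib_left
  proof (intro sum.cong refl)
    fix i assume "i \<in> {..r}"
    hence i: "i \<le> r" by simp
    have "(-1 :: bipoly) ^ (r - i) = (-1) ^ r * (-1) ^ i"
    proof -
      have "(-1 :: bipoly) ^ r * (-1) ^ i = (-1) ^ (r - i) * ((-1) ^ i * (-1) ^ i)"
        using i by (metis power_add le_add_diff_inverse2 mult.assoc)
      also have "(-1 :: bipoly) ^ i * (-1) ^ i = 1"
        by (simp flip: power_mult_distrib)
      finally show ?thesis by simp
    qed
    thus "(-1) ^ (r - i) * of_nat (r choose (r - i)) *
        ((D0 ^^ (r - (r - i))) ((D1 ^^ (r - i)) E) * (D0 ^^ (r - i)) ((D1 ^^ (r - (r - i))) F)) =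
      (-1) ^ r * ((-1) ^ i * of_nat (r choose i) *
        ((D0 ^^ (r - i)) ((D1 ^^ i) F) * (D0 ^^ i) ((D1 ^^ (r - i)) E)))"
      using i by (simp add: binomial_symmetric[of i r] mult.assoc mult.commute mult.left_commute)
  qed
  finally show ?thesis .
qed

lemma X0_Omega_process_D0_right:
  assumes "is_form f F" "r \<le> f"
  shows "X0 * Omega_process r E (D0 F) = of_nat (f - r) * Omega_process r E F - X1 * Omega_process r E (D1 F)"
  using arg_cong[OF X0_Omega_process_D0_left[OF assms, of E], of "\<lambda>P. (-1) ^ r * P"]
  unfolding Omega_process_swap[of r E] by (simp add: algebra_simps)

text \<open>
  One Omega factor is split off and multiplied by $x_0$. Eliminating \<open>D0\<close> by Euler's relation in
  both of its summands produces the term $x_1 (\partial_1 E, \partial_1 F)_r$ twice with opposite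
  signs, so $x_1$ cancels. After normalisation each remaining term is
  weighted only by the order of the form that is differentiated in it.
\<close>

lemma transvectant_Suc:
  assumes "is_form e E" "is_form f F" "r < e" "r < f"
  shows "X0 * transvectant e f (Suc r) E F =
    bconst (1 / of_nat f) * transvectant e (f - 1) r E (D1 F) -
    bconst (1 / of_nat e) * transvectant (e - 1) f r (D1 E) F"
proof -
  let ?c = "fact (e - Suc r) * fact (f - Suc r) / (fact e * fact f) :: complex"
  have "X0 * Omega_process (Suc r) E F =
      of_nat (e - r) * Omega_process r E (D1 F) - of_nat (f - r) * Omega_process r (D1 E) F"
    using assms
    by (simp add: Omega_process_Suc X0_Omega_process_D0_left X0_Omega_process_D0_right right_diff_distrib
     )
  hence main: "X0 * transvectant e f (Suc r) E F =
      bconst (?c * of_nat (e - r)) * Omega_process r E (D1 F) -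
      bconst (?c * of_nat (f - r)) * Omega_process r (D1 E) F"
    using assms
    by (simp only: transvectant_Omega_process Suc_le_eq mult.left_commute[of X0])
      (simp only: bconst_mult bconst_of_nat right_diff_distrib mult.assoc)
  have fe: "fact (e - r) = (of_nat (e - r) * fact (e - Suc r) :: complex)"
    using assms by (metis Suc_diff_Suc fact_Suc)
  have ff: "fact (f - r) = (of_nat (f - r) * fact (f - Suc r) :: complex)"
    using assms by (metis Suc_diff_Suc fact_Suc)
  have e: "fact e = (of_nat e * fact (e - 1) :: complex)"
    using assms by (intro fact_reduce) simp
  have f: "fact f = (of_nat f * fact (f - 1) :: complex)"
    using assms by (intro fact_reduce) simp
  have "?c * of_nat (e - r) = 1 / of_nat f * (fact (e - r) * fact (f - 1 - r) / (fact e * fact (f - 1)))"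
    unfolding fe by (subst f) (simp add: ac_simps)
  moreover have "?c * of_nat (f - r) = 1 / of_nat e * (fact (e - 1 - r) * fact (f - r) / (fact (e - 1) * fact f))"
    unfolding ff by (subst e) (simp add: ac_simps)
  ultimately show ?thesis
    using assms unfolding main
    by (simp only: transvectant_Omega_process bconst_mult mult.assoc less_imp_le Suc_leI le_diff_conv2
      One_nat_def Suc_pred' Suc_le_eq)
qed

text \<open>
  The factor makes \<open>jet e k P\<close>, at $x_0 = 1$ and $x_1 = 0$, the coefficient $a_k$ of the form
  $P = \sum_k \binom{e}{k} a_k x_0^{e-k} x_1^k$.
\<close>

definition jet :: "nat \<Rightarrow> nat \<Rightarrow> bipoly \<Rightarrow> bipoly" where
  "jet e k P = bconst (fact (e - k) / fact e) * (D1 ^^ k) P"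

lemma jet_0 [simp]: "jet e 0 P = P"
  by (simp add: jet_def)

lemma D1_jet:
  assumes "k < e"
  shows "D1 (jet e k P) = (of_nat e - of_nat k) * jet e (Suc k) P"
proof -
  have "fact (e - k) = (of_nat (e - k) * fact (e - Suc k) :: complex)"
    using assms by (metis Suc_diff_Suc fact_Suc)
  hence "bconst (fact (e - k) / fact e) =
      (of_nat e - of_nat k) * bconst (fact (e - Suc k) / fact e)"
    using assms by (simp add: bconst_hom of_nat_diff flip: times_divide_eq_right)
  thus ?thesis by (simp add: jet_def D1_mult D1_diff)
qed

lemma jet_D1:
  assumes "0 < e"
  shows "bconst (1 / of_nat e) * jet (e - 1) k (D1 P) = jet e (Suc k) P"
proof -
  have e: "fact e = (of_nat e * fact (e - 1) :: complex)"
    using assms by (intro fact_reduce) simp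
  have "bconst (1 / of_nat e) * jet (e - 1) k (D1 P) =
      bconst (1 / of_nat e * (fact (e - 1 - k) / fact (e - 1))) * (D1 ^^ Suc k) P"
    by (simp only: jet_def bconst_mult mult.assoc funpow_Suc_right comp_def)
  also have "1 / of_nat e * (fact (e - 1 - k) / fact (e - 1)) = (fact (e - Suc k) / fact e :: complex)"
    by (subst e) simp
  finally show ?thesis by (simp add: jet_def)
qed

text \<open>
  The classical expression of a transvectant in one inhomogeneous variable, kept homogeneous by the
  power of $x_0$. The recursion of \<open>transvectant_Suc\<close> and Pascal's rule agree because
  \<open>1 / e\<close> is exactly the ratio between the jets of \<open>D1 E\<close> and those of \<open>E\<close>.
\<close>

theorem transvectant_jet:
  assumes "is_form e E" "is_form f F" "r \<le> e" "r \<le> f"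
  shows "X0 ^ r * transvectant e f r E F =
    (\<Sum>i\<le>r. (-1) ^ i * of_nat (r choose i) * (jet e i E * jet f (r - i) F))"
  using assms
proof (induction r arbitrary: e f E F)
  case 0
  show ?case by (simp add: transvectant_def)
next
  case (Suc r)
  let ?s = "\<lambda>i. (-1) ^ i * of_nat (r choose i) :: bipoly"
  have pos: "0 < e" "0 < f" and le: "r \<le> e - 1" "r \<le> f - 1" "r \<le> e" "r \<le> f"
    using Suc.prems by auto
  have "X0 ^ Suc r * transvectant e f (Suc r) E F =
      bconst (1 / of_nat f) * (X0 ^ r * transvectant e (f - 1) r E (D1 F)) -
      bconst (1 / of_nat e) * (X0 ^ r * transvectant (e - 1) f r (D1 E) F)"
    using Suc.prems
    by (simp only: power_Suc2 mult.assoc transvectant_Suc Suc_le_eq) (simp only: algebra_simps)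
  also have "X0 ^ r * transvectant e (f - 1) r E (D1 F) =
      (\<Sum>i\<le>r. ?s i * (jet e i E * jet (f - 1) (r - i) (D1 F)))"
    using Suc.prems le by (intro Suc.IH is_form_D1)
  also have "X0 ^ r * transvectant (e - 1) f r (D1 E) F =
      (\<Sum>i\<le>r. ?s i * (jet (e - 1) i (D1 E) * jet f (r - i) F))"
    using Suc.prems le by (intro Suc.IH is_form_D1)
  also have "bconst (1 / of_nat f) * (\<Sum>i\<le>r. ?s i * (jet e i E * jet (f - 1) (r - i) (D1 F))) =
      (\<Sum>i\<le>r. ?s i * (jet e i E * jet f (Suc r - i) F))"
    unfolding sum_distrib_left
    by (intro sum.cong refl) (simp add: Suc_diff_le ac_simps flip: jet_D1[OF pos(2)])
  also have "bconst (1 / of_nat e) * (\<Sum>i\<le>r. ?s i * (jet (e - 1) i (D1 E) * jet f (r - i) F)) =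
      (\<Sum>i\<le>r. ?s i * (jet e (Suc i) E * jet f (Suc r - Suc i) F))"
    unfolding sum_distrib_left
    by (intro sum.cong refl) (simp add: ac_simps flip: jet_D1[OF pos(1)])
  finally show ?case by (simp only: alternating_Pascal_sum)
qed

section \<open>The Wronskian\<close>

text \<open>Compare leading coefficients: those of the two products carry the factors
  \<open>degree Q\<close> and \<open>degree P\<close>.\<close>

lemma degree_eq_of_Wronskian_eq_0:
  fixes P Q :: "'a :: {idom, ring_char_0} poly"
  assumes "P * pderiv Q = Q * pderiv P" "P \<noteq> 0" "Q \<noteq> 0"
  shows "degree P = degree Q"
proof -
  have lead: "lead_coeff (pderiv R) = of_nat (degree R) * lead_coeff R" for R :: "'a poly"
    by (cases "degree R") (auto simp: degree_pderiv coeff_pderiv pderiv_eq_0_iff[THEN iffD2])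
  have "lead_coeff P * (of_nat (degree Q) * lead_coeff Q) =
      lead_coeff Q * (of_nat (degree P) * lead_coeff P)"
    using arg_cong[OF assms(1), of lead_coeff] by (simp only: lead_coeff_mult lead)
  thus ?thesis
    using assms(2,3) by (simp add: ac_simps)
qed

text \<open>
  Nonzero polynomials with vanishing Wronskian have equal degrees in $x_1$. The vanishing survives replacing \<open>B\<close> by a combination
  in which the leading term of \<open>A\<close> is cancelled, so that combination must be zero. Homogeneity
  matters here: it makes the leading coefficients in $x_1$ monomials of the same degree in $x_0$, so
  the cancelling multipliers can be taken in the complex numbers.
\<close>

lemma lin_indep2_imp_Wronskian_neq_0:
  assumes A: "is_form d A" and B: "is_form d B" and indep: "lin_indep2 A B"
  shows "A * D1 B - B * D1 A \<noteq> 0"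
proof
  assume "A * D1 B - B * D1 A = 0"
  hence W: "A * D1 B = B * D1 A" by simp
  have "A \<noteq> 0"
    using indep unfolding lin_indep2_def by (metis add_0_right bconst_0 bconst_1 mult_1 mult_zero_left zero_neq_one)
  define m where "m = degree A"
  define a b where "a = coeff (coeff A m) (d - m)" and "b = coeff (coeff B m) (d - m)"
  have coeff_m: "coeff P m = monom (coeff (coeff P m) (d - m)) (d - m)" if "is_form d P" for P
  proof (rule poly_eqI)
    fix i show "coeff (coeff P m) i = coeff (monom (coeff (coeff P m) (d - m)) (d - m)) i"
      using that unfolding is_form_def by (cases "coeff (coeff P m) i = 0") fastforce+
  qed
  have "coeff A m \<noteq> 0" using \<open>A \<noteq> 0\<close> by (simp add: m_def)
  hence "a \<noteq> 0" using coeff_m[OF A] by (auto simp: a_def)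
  define C where "C = bconst b * A + bconst (- a) * B"
  have "C \<noteq> 0"
    using indep \<open>a \<noteq> 0\<close> unfolding lin_indep2_def C_def by (metis neg_equal_0_iff_equal)
  have "A * D1 C = C * D1 A"
    using W by (simp add: C_def D1_add D1_mult algebra_simps)
  hence "degree A = degree C"
    using \<open>A \<noteq> 0\<close> \<open>C \<noteq> 0\<close> unfolding D1_def by (rule degree_eq_of_Wronskian_eq_0)
  moreover have "coeff C m = 0"
  proof -
    have "coeff C m = smult b (coeff A m) - smult a (coeff B m)"
      by (simp add: C_def coeff_bconst_mult)
    also have "\<dots> = 0"
      by (subst coeff_m[OF A], subst coeff_m[OF B]) (simp add: a_def b_def smult_monom)
    finally show ?thesis .
  qed
  ultimately show False
    using \<open>C \<noteq> 0\<close> by (simp add: m_def)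
qed

section \<open>The quadratic syzygy\<close>

text \<open>
  The variables \<open>t1k\<close>, \<open>t3k\<close> stand for the jets of $T_1$ and $T_3$. All hypotheses and the conclusion
  are cleared of denominators, so that the identity makes sense in the polynomial ring itself.
\<close>

lemma syzygy_of_brackets:
  fixes n :: "'a :: idom"
  assumes t1: "t10 = p01" "2 * t11 = p02" "2 * (2 * n - 3) * t12 = n * p12 + (n - 2) * p03"
      "4 * (2 * n - 3) * t13 = 2 * n * p13 + (n - 3) * p04"
      "4 * (2 * n - 3) * (2 * n - 5) * t14 =
        2 * n * (n - 1) * p23 + 3 * n * (n - 3) * p14 + (n - 3) * (n - 4) * p05"
    and t3: "t30 = p03 - 3 * p12" "2 * t31 = p04 - 2 * p13"
      "2 * (2 * n - 7) * t32 = (6 - n) * p14 + (n - 4) * p05 - 2 * (n - 1) * p23"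
    and t5: "t5 = p05 - 5 * p14 + 10 * p23"
    and Plucker: "p01 * p23 - p02 * p13 + p03 * p12 = 0"
  shows "(n - 3) * (n - 4) * (2 * n - 3)\<^sup>2 * (t10 * t5) =
    (2 * n - 5) * (2 * n - 7) *
      (- 2 * (2 * n - 3)\<^sup>2 * (2 * (t10 * t14) - 8 * (t11 * t13) + 6 * (t12 * t12)) +
       4 * (2 * n - 3) * (n - 3) * (t10 * t32 - 2 * (t11 * t31) + t12 * t30) +
       n * (n - 2) * t30\<^sup>2)"
proof -
  \<comment> \<open>Regroup so that each jet occurs with exactly the factor for which it is known.\<close>
  have "(2 * n - 5) * (2 * n - 7) *
      (- 2 * (2 * n - 3)\<^sup>2 * (2 * (t10 * t14) - 8 * (t11 * t13) + 6 * (t12 * t12)) +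
       4 * (2 * n - 3) * (n - 3) * (t10 * t32 - 2 * (t11 * t31) + t12 * t30) +
       n * (n - 2) * t30\<^sup>2) =
    - ((2 * n - 7) * (2 * n - 3) * t10 * (4 * (2 * n - 3) * (2 * n - 5) * t14))
    + (2 * n - 5) * (2 * n - 7) *
       (2 * (2 * n - 3) * (2 * t11) * (4 * (2 * n - 3) * t13)
        - 3 * (2 * (2 * n - 3) * t12)\<^sup>2
        - 2 * (2 * n - 3) * (n - 3) * (2 * t11) * (2 * t31)
        + 2 * (n - 3) * (2 * (2 * n - 3) * t12) * t30 + n * (n - 2) * t30\<^sup>2)
    + 2 * (2 * n - 5) * (2 * n - 3) * (n - 3) * t10 * (2 * (2 * n - 7) * t32)"
    by algebra
  \<comment> \<open>The cofactor of the Pluecker relation is read off from the terms in \<open>p01 * p23\<close>.\<close>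
  also have "\<dots> = (n - 3) * (n - 4) * (2 * n - 3)\<^sup>2 * (t10 * t5) +
     (- ((2 * n - 7) * (2 * n - 3) * (2 * n * (n - 1))) - 4 * (2 * n - 5) * (2 * n - 3) * (n - 3) * (n - 1)
      - 10 * (n - 3) * (n - 4) * (2 * n - 3)\<^sup>2) * (p01 * p23 - p02 * p13 + p03 * p12)"
    unfolding t1 t3 t5 by algebra
  also have "\<dots> = (n - 3) * (n - 4) * (2 * n - 3)\<^sup>2 * (t10 * t5)"
    using Plucker by simp
  finally show ?thesis by simp
qed

text \<open>
  The jets of $T_1$ and $T_3$, with the powers of $x_0$ that clear them, are found one after the other
  by differentiating the expression of the previous one in the brackets \<open>p i j\<close>.
\<close>

theorem transvectant_syzygy:
  fixes d :: nat and A B :: bipoly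
  assumes d: "d \<ge> 5" and A: "is_form d A" and B: "is_form d B"
  defines "n \<equiv> of_nat d :: bipoly"
    and "T \<equiv> \<lambda>i. transvectant d d i A B"
  shows "(n - 3) * (n - 4) * (2 * n - 3)\<^sup>2 * (T 1 * T 5) =
    (2 * n - 5) * (2 * n - 7) *
      (- 2 * (2 * n - 3)\<^sup>2 * transvectant (2 * d - 2) (2 * d - 2) 4 (T 1) (T 1) +
       4 * (2 * n - 3) * (n - 3) * transvectant (2 * d - 2) (2 * d - 6) 2 (T 1) (T 3) +
       n * (n - 2) * (T 3)\<^sup>2)"
proof -
  define p where "p = (\<lambda>i j. jet d i A * jet d j B - jet d j A * jet d i B)"
  define t1 where "t1 = (\<lambda>k. X0 * jet (2 * d - 2) k (T 1))"
  define t3 where "t3 = (\<lambda>k. X0 ^ 3 * jet (2 * d - 6) k (T 3))"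
  have Dp: "D1 (p i j) = (n - of_nat i) * p (Suc i) j + (n - of_nat j) * p i (Suc j)"
    if "i < d" "j < d" for i j
    using that by (simp add: p_def D1_diff D1_mult D1_jet n_def algebra_simps)
  have pii: "p i i = 0" for i by (simp add: p_def)
  have nz: "n - of_nat k \<noteq> 0" if "k < d" for k
    using that by (simp add: n_def)
  have o1: "of_nat (2 * d - 2) = 2 * n - 2" and o3: "of_nat (2 * d - 6) = 2 * n - 6"
    using d by (simp_all add: n_def of_nat_diff)
  have Dt1: "D1 (t1 k) = (2 * n - 2 - of_nat k) * t1 (Suc k)" if "k < 2 * d - 2" for k
    using that by (simp only: t1_def D1_mult D1_jet o1) (simp add: ac_simps)
  have Dt3: "D1 (t3 k) = (2 * n - 6 - of_nat k) * t3 (Suc k)" if "k < 2 * d - 6" for k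
    using that by (simp only: t3_def D1_mult D1_jet o3) (simp add: ac_simps)
  have e1: "is_form (2 * d - 2) (T 1)" and e3: "is_form (2 * d - 6) (T 3)"
    using is_form_transvectant[OF A B, of 1] is_form_transvectant[OF A B, of 3]
    by (simp_all add: T_def mult_2)
  have T: "X0 ^ r * T r = (\<Sum>i\<le>r. (-1) ^ i * of_nat (r choose i) * (jet d i A * jet d (r - i) B))"
    if "r \<le> 5" for r
    unfolding T_def using that d by (intro transvectant_jet A B) simp_all

  have t10: "t1 0 = p 0 1"
    using T[of 1] by (simp add: t1_def p_def)
  have t30: "t3 0 = p 0 3 - 3 * p 1 2"
    using T[of 3] by (simp add: t3_def p_def eval_nat_numeral algebra_simps)
  have t5: "X0 ^ 5 * T 5 = p 0 5 - 5 * p 1 4 + 10 * p 2 3"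
    using T[of 5] by (simp add: p_def eval_nat_numeral algebra_simps)
  have Dn: "D1 n = 0" by (simp add: n_def)
  have Dp': "D1 (p 0 1) = (n - 1) * p 0 2" "D1 (p 0 2) = n * p 1 2 + (n - 2) * p 0 3"
      "D1 (p 0 3) = n * p 1 3 + (n - 3) * p 0 4" "D1 (p 0 4) = n * p 1 4 + (n - 4) * p 0 5"
      "D1 (p 1 2) = (n - 2) * p 1 3" "D1 (p 1 3) = (n - 1) * p 2 3 + (n - 3) * p 1 4"
    using Dp[of 0 1] Dp[of 0 2] Dp[of 0 3] Dp[of 0 4] Dp[of 1 2] Dp[of 1 3] pii[of 1] pii[of 2] d
    by (simp_all add: eval_nat_numeral)
  have Dt1': "D1 (t1 0) = 2 * (n - 1) * t1 1" "D1 (t1 1) = (2 * n - 3) * t1 2"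
      "D1 (t1 2) = 2 * (n - 2) * t1 3" "D1 (t1 3) = (2 * n - 5) * t1 4"
    using Dt1[of 0] Dt1[of 1] Dt1[of 2] Dt1[of 3] d
    by (simp_all add: eval_nat_numeral algebra_simps)
  have Dt3': "D1 (t3 0) = 2 * (n - 3) * t3 1" "D1 (t3 1) = (2 * n - 7) * t3 2"
    using Dt3[of 0] Dt3[of 1] d by (simp_all add: eval_nat_numeral algebra_simps)
  note D_rules = D1_mult D1_add D1_diff Dn Dp' Dt1' Dt3'

  \<comment> \<open>Where the new jet and its expression share a factor, it is cancelled before the next step.\<close>
  have "(n - 1) * (2 * t1 1) = (n - 1) * p 0 2"
    using arg_cong[OF t10, of D1] by (simp add: D_rules ac_simps del: One_nat_def)
  hence t11: "2 * t1 1 = p 0 2" using nz[of 1] d by simp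
  have t12: "2 * (2 * n - 3) * t1 2 = n * p 1 2 + (n - 2) * p 0 3"
    using arg_cong[OF t11, of D1] by (simp add: D_rules algebra_simps del: One_nat_def)
  have "(n - 2) * (4 * (2 * n - 3) * t1 3) = (n - 2) * (2 * n * p 1 3 + (n - 3) * p 0 4)"
    using arg_cong[OF t12, of D1] by (simp add: D_rules algebra_simps del: One_nat_def)
  hence t13: "4 * (2 * n - 3) * t1 3 = 2 * n * p 1 3 + (n - 3) * p 0 4"
    using nz[of 2] d by simp
  have t14: "4 * (2 * n - 3) * (2 * n - 5) * t1 4 =
      2 * n * (n - 1) * p 2 3 + 3 * n * (n - 3) * p 1 4 + (n - 3) * (n - 4) * p 0 5"
    using arg_cong[OF t13, of D1] by (simp add: D_rules algebra_simps del: One_nat_def)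
  have "(n - 3) * (2 * t3 1) = (n - 3) * (p 0 4 - 2 * p 1 3)"
    using arg_cong[OF t30, of D1] by (simp add: D_rules algebra_simps del: One_nat_def)
  hence t31: "2 * t3 1 = p 0 4 - 2 * p 1 3" using nz[of 3] d by simp
  have t32: "2 * (2 * n - 7) * t3 2 = (6 - n) * p 1 4 + (n - 4) * p 0 5 - 2 * (n - 1) * p 2 3"
    using arg_cong[OF t31, of D1] by (simp add: D_rules algebra_simps del: One_nat_def)
  have Plucker: "p 0 1 * p 2 3 - p 0 2 * p 1 3 + p 0 3 * p 1 2 = 0"
    unfolding p_def by algebra

  let ?TT4 = "transvectant (2 * d - 2) (2 * d - 2) 4 (T 1) (T 1)"
  let ?TT2 = "transvectant (2 * d - 2) (2 * d - 6) 2 (T 1) (T 3)"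
  let ?j1 = "\<lambda>k. jet (2 * d - 2) k (T 1)" and ?j3 = "\<lambda>k. jet (2 * d - 6) k (T 3)"
  have "X0 ^ 4 * ?TT4 = (\<Sum>i\<le>4. (-1) ^ i * of_nat (4 choose i) *
      (?j1 i * ?j1 (4 - i)))"
    using d by (intro transvectant_jet e1) simp_all
  hence "X0 ^ 4 * ?TT4 = 2 * (?j1 0 * ?j1 4) - 8 * (?j1 1 * ?j1 3) + 6 * (?j1 2 * ?j1 2)"
    by (simp add: eval_nat_numeral algebra_simps)
  hence TT4: "X0 ^ 6 * ?TT4 = 2 * (t1 0 * t1 4) - 8 * (t1 1 * t1 3) + 6 * (t1 2 * t1 2)"
    unfolding t1_def by algebra
  have "X0 ^ 2 * ?TT2 = (\<Sum>i\<le>2. (-1) ^ i * of_nat (2 choose i) *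
      (?j1 i * ?j3 (2 - i)))"
    using d by (intro transvectant_jet e1 e3) simp_all
  hence "X0 ^ 2 * ?TT2 = ?j1 0 * ?j3 2 - 2 * (?j1 1 * ?j3 1) + ?j1 2 * ?j3 0"
    by (simp add: eval_nat_numeral algebra_simps)
  hence TT2: "X0 ^ 6 * ?TT2 = t1 0 * t3 2 - 2 * (t1 1 * t3 1) + t1 2 * t3 0"
    unfolding t1_def t3_def by algebra
  have T33: "X0 ^ 6 * (T 3)\<^sup>2 = (t3 0)\<^sup>2"
    by (simp add: t3_def eval_nat_numeral ac_simps)
  have T15: "X0 ^ 6 * (T 1 * T 5) = t1 0 * (X0 ^ 5 * T 5)"
    by (simp add: t1_def eval_nat_numeral ac_simps)

  let ?L = "(n - 3) * (n - 4) * (2 * n - 3)\<^sup>2 * (T 1 * T 5)"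
  let ?R = "(2 * n - 5) * (2 * n - 7) *
      (- 2 * (2 * n - 3)\<^sup>2 * ?TT4 + 4 * (2 * n - 3) * (n - 3) * ?TT2 + n * (n - 2) * (T 3)\<^sup>2)"
  have "X0 ^ 6 * ?L = (n - 3) * (n - 4) * (2 * n - 3)\<^sup>2 * (X0 ^ 6 * (T 1 * T 5))"
    by (simp only: ac_simps)
  also have "\<dots> = (2 * n - 5) * (2 * n - 7) *
      (- 2 * (2 * n - 3)\<^sup>2 * (X0 ^ 6 * ?TT4) + 4 * (2 * n - 3) * (n - 3) * (X0 ^ 6 * ?TT2) +
       n * (n - 2) * (X0 ^ 6 * (T 3)\<^sup>2))"
    unfolding TT4 TT2 T33 T15
    by (rule syzygy_of_brackets[OF t10 t11 t12 t13 t14 t30 t31 t32 t5 Plucker])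
  also have "\<dots> = X0 ^ 6 * ?R"
    by (simp only: distrib_left ac_simps)
  finally show "?L = ?R"
    by (simp add: X0_def)
qed

theorem theorem5p5:
  fixes d :: nat and A B :: bipoly and T :: "nat \<Rightarrow> bipoly"
  assumes "d \<ge> 5"
    and "is_form d A" and "is_form d B"
    and "lin_indep2 A B"
    and "\<And>i. T i = transvectant d d i A B"
  shows "T 1 \<noteq> 0 \<and>
    to_fract (T 5) =
      1 / to_fract (T 1) *
      (to_fract (bconst (alpha1 d / alpha4 d)) *
         to_fract (transvectant (2 * d - 2) (2 * d - 2) 4 (T 1) (T 1))
       + to_fract (bconst (alpha2 d / alpha4 d)) *
         to_fract (transvectant (2 * d - 2) (2 * d - 6) 2 (T 1) (T 3))
       + to_fract (bconst (alpha3 d / alpha4 d)) * (to_fract (T 3))\<^sup>2)"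
proof (intro conjI)
  have T: "T = (\<lambda>i. transvectant d d i A B)" using assms(5) by auto
  have "X0 * T 1 = A * jet d 1 B - jet d 1 A * B"
    using transvectant_jet[OF assms(2,3), of 1] assms(1) by (simp add: T)
  also have "\<dots> = bconst (1 / of_nat d) * (A * D1 B - B * D1 A)"
    using assms(1) by (simp add: algebra_simps flip: jet_D1)
  also have "\<dots> \<noteq> 0"
    using lin_indep2_imp_Wronskian_neq_0[OF assms(2-4)] assms(1) by simp
  finally show T1: "T 1 \<noteq> 0" by auto

  let ?U = "transvectant (2 * d - 2) (2 * d - 2) 4 (T 1) (T 1)"
  let ?V = "transvectant (2 * d - 2) (2 * d - 6) 2 (T 1) (T 3)"
  define n where "n = (of_nat d :: complex)"
  have neq: "of_nat k * n \<noteq> of_nat m" if "k * d \<noteq> m" for k m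
    using that unfolding n_def by (metis of_nat_eq_iff of_nat_mult)
  have nz: "n \<noteq> 0" "n - 2 \<noteq> 0" "n - 3 \<noteq> 0" "n - 4 \<noteq> 0"
      "2 * n - 3 \<noteq> 0" "2 * n - 5 \<noteq> 0" "2 * n - 7 \<noteq> 0"
    using neq[of 1 0] neq[of 1 2] neq[of 1 3] neq[of 1 4] neq[of 2 3] neq[of 2 5] neq[of 2 7] assms(1)
    by simp_all
  define q where "q = (n - 3) * (n - 4) * (2 * n - 3)\<^sup>2"
  have q: "q \<noteq> 0" using nz by (simp add: q_def)
  have r1: "alpha1 d / alpha4 d = (2 * n - 5) * (2 * n - 7) * (- 2 * (2 * n - 3)\<^sup>2) / q"
    using nz by (simp add: alpha1_def alpha4_def Let_def q_def flip: n_def)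
  have r2: "alpha2 d / alpha4 d = (2 * n - 5) * (2 * n - 7) * (4 * (2 * n - 3) * (n - 3)) / q"
    using nz by (simp add: alpha2_def alpha4_def Let_def q_def flip: n_def)
  have r3: "alpha3 d / alpha4 d = (2 * n - 5) * (2 * n - 7) * (n * (n - 2)) / q"
    using nz by (simp add: alpha3_def alpha4_def Let_def q_def flip: n_def)
  have div: "bconst q * bconst (c / q) = bconst c" for c
    using q by (simp flip: bconst_mult)

  have "bconst q * (T 1 * T 5) =
      bconst ((2 * n - 5) * (2 * n - 7) * (- 2 * (2 * n - 3)\<^sup>2)) * ?U +
      bconst ((2 * n - 5) * (2 * n - 7) * (4 * (2 * n - 3) * (n - 3))) * ?V +
      bconst ((2 * n - 5) * (2 * n - 7) * (n * (n - 2))) * (T 3)\<^sup>2"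
  proof -
    have "bconst q * (T 1 * T 5) = bconst ((2 * n - 5) * (2 * n - 7)) *
        (bconst (- 2 * (2 * n - 3)\<^sup>2) * ?U + bconst (4 * (2 * n - 3) * (n - 3)) * ?V +
         bconst (n * (n - 2)) * (T 3)\<^sup>2)"
      using transvectant_syzygy[OF assms(1-3)] by (simp only: q_def n_def bconst_hom T)
    thus ?thesis by (simp only: bconst_mult distrib_left mult.assoc)
  qed
  also have "\<dots> = bconst q * (bconst (alpha1 d / alpha4 d) * ?U +
      bconst (alpha2 d / alpha4 d) * ?V + bconst (alpha3 d / alpha4 d) * (T 3)\<^sup>2)"
    unfolding r1 r2 r3 by (simp only: distrib_left mult.assoc [symmetric] div)
  finally have eq: "T 1 * T 5 = bconst (alpha1 d / alpha4 d) * ?U +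
      bconst (alpha2 d / alpha4 d) * ?V + bconst (alpha3 d / alpha4 d) * (T 3)\<^sup>2"
    using q by simp
  have "to_fract (T 5) = 1 / to_fract (T 1) * to_fract (T 1 * T 5)"
    using T1 by simp
  thus "to_fract (T 5) = 1 / to_fract (T 1) *
      (to_fract (bconst (alpha1 d / alpha4 d)) * to_fract ?U
       + to_fract (bconst (alpha2 d / alpha4 d)) * to_fract ?V
       + to_fract (bconst (alpha3 d / alpha4 d)) * (to_fract (T 3))\<^sup>2)"
    by (simp only: eq to_fract_add to_fract_mult power2_eq_square)
qed

end
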